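(* Let $X_1,\dots,X_n$ be independent random variables in a sub-linear expectation space $(\Omega,\mathscr{H},\widehat{\mathbb E})$ with upper capacity $\mathbb V$, let $S_k=\sum_{i=1}^kX_i$, and let $0<\alpha<1$ be a real number. If there exist real constants $\beta_{n,k}$ such that $$\mathbb V\left(S_k-S_n\ge\beta_{n,k}+\epsilon\right)\le\alpha\quad\text{for all }\epsilon>0\text{ and }k=1,\dots,n,$$ then $$(1-\alpha)\,\mathbb V\left(\max_{k\le n}(S_k-\beta_{n,k})>x+\epsilon\right)\le\mathbb V(S_n>x)\quad\text{for all }x>0,\ \epsilon>0.$$ If there exist real constants $\beta_{n,k}$ such that $$\mathbb V\left(|S_k-S_n|\ge\beta_{n,k}+\epsilon\right)\le\alpha\quad\text{for all }\epsilon>0\text{ and }k=1,\dots,n,$$ then $$(1-\alpha)\,\mathbb V\left(\max_{k\le n}(|S_k|-\beta_{n,k})>x+\epsilon\right)\le\mathbb V(|S_n|>x)\quad\text{for all }x>0,\ \epsilon>0.$$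
   Context: Framework. $(\Omega,\mathcal F)$ is a measurable space and $\mathscr{H}$ is a linear space of real ($\mathcal F$-measurable) functions on $\Omega$ such that $X_1,\dots,X_n\in\mathscr{H}$ implies $\varphi(X_1,\dots,X_n)\in\mathscr{H}$ for every $\varphi\in C_{l,Lip}(\mathbb R^n)$, where $C_{l,Lip}(\mathbb R^n)$ is the space of functions $\varphi$ with $|\varphi(x)-\varphi(y)|\le C(1+|x|^m+|y|^m)|x-y|$ for all $x,y\in\mathbb R^n$, for some $C>0$, $m\in\mathbb N$ depending on $\varphi$. Elements of $\mathscr{H}$ are the random variables in the space. A sub-linear expectation on $\mathscr{H}$ is a function $\widehat{\mathbb E}:\mathscr{H}\to[-\infty,\infty]$ such that for all $X,Y\in\mathscr{H}$: (a) $X\ge Y$ implies $\widehat{\mathbb E}[X]\ge\widehat{\mathbb E}[Y]$; (b) $\widehat{\mathbb E}[c]=c$ for constants $c$; (c) $\widehat{\mathbb E}[X+Y]\le\widehat{\mathbb E}[X]+\widehat{\mathbb E}[Y]$ whenever the right side is not of the form $+\infty-\infty$ or $-\infty+\infty$; (d) $\widehat{\mathbb E}[\lambda X]=\lambda\widehat{\mathbb E}[X]$ for $\lambda\ge 0$. The triple $(\Omega,\mathscr{H},\widehat{\mathbb E})$ is called a sub-linear expectation space. Capacity. $\mathbb V(A):=\inf\{\widehat{\mathbb E}[\xi]: I_A\le\xi,\ \xi\in\mathscr{H}\}$ for $A\in\mathcal F$. Independence. Let $C_{b,Lip}$ denote bounded Lipschitz functions. A random vector $Y=(Y_1,\dots,Y_n)$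 ($Y_i\in\mathscr{H}$) is independent to $X=(X_1,\dots,X_m)$ ($X_i\in\mathscr{H}$) if $\widehat{\mathbb E}[\varphi(X,Y)]=\widehat{\mathbb E}\big[\widehat{\mathbb E}[\varphi(x,Y)]|_{x=X}\big]$ for all $\varphi\in C_{b,Lip}(\mathbb R^m\times\mathbb R^n)$. Random variables $X_1,\dots,X_n$ are independent if $X_{i+1}$ is independent to $(X_1,\dots,X_i)$ for each $1\le i<n$. *)

theory Defs
  imports "HOL-Analysis.Analysis"
begin

text \<open>
  A vector in $R^n$, with \<open>n\<close> varying, is a function of type \<open>nat \<Rightarrow> real\<close> of which only the
  coordinates \<open>i < n\<close> matter; \<open>L2_set x {..<n}\<close> is its Euclidean norm. Each of the two estimates
  below forces \<open>\<phi> x = \<phi> y\<close> whenever \<open>x\<close> and \<open>y\<close> agree on \<open>{..<n}\<close>, so \<open>\<phi>\<close> is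
  a function on $R^n$.
\<close>

definition C_l_Lip :: "nat \<Rightarrow> ((nat \<Rightarrow> real) \<Rightarrow> real) set" where
  "C_l_Lip n = {\<phi>. \<exists>C>0. \<exists>m::nat. \<forall>x y.
     \<bar>\<phi> x - \<phi> y\<bar> \<le> C * (1 + L2_set x {..<n} ^ m + L2_set y {..<n} ^ m)
                       * L2_set (\<lambda>i. x i - y i) {..<n}}"

definition C_b_Lip :: "nat \<Rightarrow> ((nat \<Rightarrow> real) \<Rightarrow> real) set" where
  "C_b_Lip n = {\<phi>. (\<exists>B. \<forall>x. \<bar>\<phi> x\<bar> \<le> B) \<and>
     (\<exists>L. \<forall>x y. \<bar>\<phi> x - \<phi> y\<bar> \<le> L * L2_set (\<lambda>i. x i - y i) {..<n})}"

text \<open>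
  Only \<open>space M\<close> and \<open>sets M\<close> are used, not the measure of \<open>M\<close>. Functions are
  compared on \<open>space M\<close> only, so by \<open>mono\<close> the value \<open>E X\<close> does not depend on \<open>X\<close> outside
  \<open>space M\<close>. The values of \<open>E\<close> outside \<open>H\<close> are irrelevant. In \<open>pos_homogeneous\<close>, the
  product \<open>0 * \<infinity>\<close> is \<open>0\<close>.
\<close>

locale sublinear_expectation_space =
  fixes M :: "'a measure"
    and H :: "('a \<Rightarrow> real) set"
    and E :: "('a \<Rightarrow> real) \<Rightarrow> ereal"
  assumes H_measurable: "H \<subseteq> borel_measurable M"
    and H_zero: "(\<lambda>\<omega>. 0) \<in> H"
    and H_add: "\<lbrakk>X \<in> H; Y \<in> H\<rbrakk> \<Longrightarrow> (\<lambda>\<omega>. X \<omega> + Y \<omega>) \<in> H"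
    and H_scale: "X \<in> H \<Longrightarrow> (\<lambda>\<omega>. c * X \<omega>) \<in> H"
    and H_compose: "\<lbrakk>\<And>i. i < n \<Longrightarrow> Z i \<in> H; \<phi> \<in> C_l_Lip n\<rbrakk> \<Longrightarrow> (\<lambda>\<omega>. \<phi> (\<lambda>i. Z i \<omega>)) \<in> H"
    and mono: "\<lbrakk>X \<in> H; Y \<in> H; \<And>\<omega>. \<omega> \<in> space M \<Longrightarrow> Y \<omega> \<le> X \<omega>\<rbrakk> \<Longrightarrow> E Y \<le> E X"
    and const: "E (\<lambda>\<omega>. c) = ereal c"
    and subadd: "\<lbrakk>X \<in> H; Y \<in> H; \<not> (E X = \<infinity> \<and> E Y = -\<infinity>); \<not> (E X = -\<infinity> \<and> E Y = \<infinity>)\<rbrakk>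
        \<Longrightarrow> E (\<lambda>\<omega>. X \<omega> + Y \<omega>) \<le> E X + E Y"
    and pos_homogeneous: "\<lbrakk>X \<in> H; 0 \<le> c\<rbrakk> \<Longrightarrow> E (\<lambda>\<omega>. c * X \<omega>) = ereal c * E X"

definition upper_capacity ::
  "'a measure \<Rightarrow> ('a \<Rightarrow> real) set \<Rightarrow> (('a \<Rightarrow> real) \<Rightarrow> ereal) \<Rightarrow> 'a set \<Rightarrow> ereal" where
  "upper_capacity M H E A = Inf {E \<xi> | \<xi>. \<xi> \<in> H \<and> (\<forall>\<omega>\<in>space M. indicator A \<omega> \<le> \<xi> \<omega>)}"

text \<open>The concatenation of a vector in $R^m$ and a further vector.\<close>

definition join :: "nat \<Rightarrow> (nat \<Rightarrow> real) \<Rightarrow> (nat \<Rightarrow> real) \<Rightarrow> (nat \<Rightarrow> real)" where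
  "join m x y = (\<lambda>i. if i < m then x i else y (i - m))"

text \<open>
  \<open>Y = (Y 0, \<dots>, Y (n - 1))\<close> is independent to \<open>X = (X 0, \<dots>, X (m - 1))\<close>. The inner
  expectation is that of a bounded member of \<open>H\<close>, hence finite (by \<open>mono\<close> and \<open>const\<close>), and
  \<open>real_of_ereal\<close> loses nothing.
\<close>

definition independent_to ::
  "('a \<Rightarrow> real) set \<Rightarrow> (('a \<Rightarrow> real) \<Rightarrow> ereal) \<Rightarrow>
   nat \<Rightarrow> (nat \<Rightarrow> 'a \<Rightarrow> real) \<Rightarrow> nat \<Rightarrow> (nat \<Rightarrow> 'a \<Rightarrow> real) \<Rightarrow> bool" where
  "independent_to H E n Y m X \<longleftrightarrow>
     (\<forall>i<n. Y i \<in> H) \<and> (\<forall>i<m. X i \<in> H) \<and>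
     (\<forall>\<phi>\<in>C_b_Lip (m + n).
        E (\<lambda>\<omega>. \<phi> (join m (\<lambda>i. X i \<omega>) (\<lambda>i. Y i \<omega>))) =
        E (\<lambda>\<omega>. real_of_ereal (E (\<lambda>\<omega>'. \<phi> (join m (\<lambda>i. X i \<omega>) (\<lambda>i. Y i \<omega>'))))))"

text \<open>Here the random variables are \<open>X 1, \<dots>, X n\<close>.\<close>

definition independent_rvs ::
  "('a \<Rightarrow> real) set \<Rightarrow> (('a \<Rightarrow> real) \<Rightarrow> ereal) \<Rightarrow> nat \<Rightarrow> (nat \<Rightarrow> 'a \<Rightarrow> real) \<Rightarrow> bool" where
  "independent_rvs H E n X \<longleftrightarrow>
     (\<forall>i\<in>{1..n}. X i \<in> H) \<and>
     (\<forall>i. 1 \<le> i \<and> i < n \<longrightarrow> independent_to H E 1 (\<lambda>_. X (i + 1)) i (\<lambda>j. X (j + 1)))"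

end

theory Submission
  imports Defs
begin

text \<open>
  Both claims are Ottaviani's inequality, once for \<open>f\<close> the identity and once for \<open>f\<close> the absolute
  value; the argument uses of \<open>f\<close> only that it is subadditive and nonexpansive.

  Classically one splits the event \<open>max\<^sub>k (f S\<^sub>k - \<beta>\<^sub>k) > x + \<epsilon>\<close> according to the first passage
  time \<open>k\<close> and uses that the increment \<open>S\<^sub>n - S\<^sub>k\<close> is independent of the past. Two features of a
  sub-linear expectation \<open>E\<close> stand in the way. First, independence speaks about bounded Lipschitz
  functions only, so indicators are replaced by ramps, with the gap \<open>\<epsilon>\<close> making room for the four
  thresholds involved. The indicator of first passage at time \<open>k\<close> becomes the increment
  \<open>D\<^sub>k = W\<^sub>k - W\<^bsub>k-1\<^esub> \<ge> 0\<close> of the running maximum \<open>W\<^sub>k\<close> of ramps; these increments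
  telescope to \<open>W\<^sub>n\<close>, which dominates the indicator of the maximal event. Second, \<open>E\<close> is not
  additive, so the estimate \<open>E (\<Sum>\<^sub>k D\<^sub>k p\<^sub>k) \<le> \<alpha> E (\<Sum>\<^sub>k D\<^sub>k)\<close> cannot be got by summing over \<open>k\<close>, where
  \<open>p\<^sub>k\<close> is the ramp in \<open>f (S\<^sub>k - S\<^sub>n)\<close> with \<open>E p\<^sub>k \<le> \<alpha>\<close>. The remedy is to move the constant
  inside: pointwise
  \<open>(1 - \<alpha>) W\<^sub>n \<le> h(S\<^sub>n) + \<Sum>\<^sub>k D\<^sub>k (p\<^sub>k - \<alpha>)\<close>,
  where \<open>h\<close> is a ramp below the indicator of \<open>f > x\<close>. Each term \<open>D\<^sub>k (p\<^sub>k - \<alpha>)\<close> has nonpositive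
  expectation, and nonpositivity does survive sums by subadditivity.

  The sign of these expectations is the content of
  \<open>expectation_past_times_future_nonpos\<close>: integrating out the last variable, then the one before it,
  and so on, replaces the future factor by a constant, namely its own expectation
  (\<open>expectation_future_reduces_to_const\<close>).
\<close>

section \<open>Bounded Lipschitz functions\<close>

definition bounded_lipschitz :: "(real \<Rightarrow> real) \<Rightarrow> bool" where
  "bounded_lipschitz u \<longleftrightarrow> (\<exists>B. \<forall>t. \<bar>u t\<bar> \<le> B) \<and> (\<exists>L. \<forall>s t. \<bar>u s - u t\<bar> \<le> L * \<bar>s - t\<bar>)"

lemma C_b_LipE:
  assumes "\<phi> \<in> C_b_Lip n"
  obtains B L where "0 \<le> B" "\<And>x. \<bar>\<phi> x\<bar> \<le> B"
    "0 \<le> L" "\<And>x y. \<bar>\<phi> x - \<phi> y\<bar> \<le> L * L2_set (\<lambda>i. x i - y i) {..<n}"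
proof -
  obtain B L where B: "\<And>x. \<bar>\<phi> x\<bar> \<le> B"
    and L: "\<And>x y. \<bar>\<phi> x - \<phi> y\<bar> \<le> L * L2_set (\<lambda>i. x i - y i) {..<n}"
    using assms unfolding C_b_Lip_def by blast
  have "0 \<le> B" using B[of undefined] abs_ge_zero order_trans by blast
  moreover have "\<bar>\<phi> x - \<phi> y\<bar> \<le> \<bar>L\<bar> * L2_set (\<lambda>i. x i - y i) {..<n}" for x y
    by (rule order_trans[OF L]) (intro mult_right_mono, auto)
  ultimately show thesis using B that[of B "\<bar>L\<bar>"] by auto
qed

lemma C_b_LipI:
  assumes "\<And>x. \<bar>\<phi> x\<bar> \<le> B" "\<And>x y. \<bar>\<phi> x - \<phi> y\<bar> \<le> L * L2_set (\<lambda>i. x i - y i) {..<n}"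
  shows "\<phi> \<in> C_b_Lip n"
  using assms unfolding C_b_Lip_def by blast

lemma C_b_Lip_const: "(\<lambda>_. c) \<in> C_b_Lip n"
  by (rule C_b_LipI[of _ "\<bar>c\<bar>" 0]) auto

lemma C_b_Lip_diff:
  assumes "\<phi> \<in> C_b_Lip n" "\<psi> \<in> C_b_Lip n"
  shows "(\<lambda>x. \<phi> x - \<psi> x) \<in> C_b_Lip n"
proof -
  obtain B L where 1: "0 \<le> B" "\<And>x. \<bar>\<phi> x\<bar> \<le> B" "0 \<le> L"
    "\<And>x y. \<bar>\<phi> x - \<phi> y\<bar> \<le> L * L2_set (\<lambda>i. x i - y i) {..<n}"
    using assms(1) by (rule C_b_LipE) (rule that)
  obtain B' L' where 2: "0 \<le> B'" "\<And>x. \<bar>\<psi> x\<bar> \<le> B'" "0 \<le> L'"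
    "\<And>x y. \<bar>\<psi> x - \<psi> y\<bar> \<le> L' * L2_set (\<lambda>i. x i - y i) {..<n}"
    using assms(2) by (rule C_b_LipE) (rule that)
  show ?thesis
  proof (rule C_b_LipI[of _ "B + B'" "L + L'"])
    show "\<bar>\<phi> x - \<psi> x\<bar> \<le> B + B'" for x using 1(2)[of x] 2(2)[of x] by linarith
    show "\<bar>\<phi> x - \<psi> x - (\<phi> y - \<psi> y)\<bar> \<le> (L + L') * L2_set (\<lambda>i. x i - y i) {..<n}" for x y
      using 1(4)[of x y] 2(4)[of x y] by (simp add: distrib_right)
  qed
qed

lemma C_b_Lip_mult:
  assumes "\<phi> \<in> C_b_Lip n" "\<psi> \<in> C_b_Lip n"
  shows "(\<lambda>x. \<phi> x * \<psi> x) \<in> C_b_Lip n"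
proof -
  obtain B L where 1: "0 \<le> B" "\<And>x. \<bar>\<phi> x\<bar> \<le> B" "0 \<le> L"
    "\<And>x y. \<bar>\<phi> x - \<phi> y\<bar> \<le> L * L2_set (\<lambda>i. x i - y i) {..<n}"
    using assms(1) by (rule C_b_LipE) (rule that)
  obtain B' L' where 2: "0 \<le> B'" "\<And>x. \<bar>\<psi> x\<bar> \<le> B'" "0 \<le> L'"
    "\<And>x y. \<bar>\<psi> x - \<psi> y\<bar> \<le> L' * L2_set (\<lambda>i. x i - y i) {..<n}"
    using assms(2) by (rule C_b_LipE) (rule that)
  show ?thesis
  proof (rule C_b_LipI[of _ "B * B'" "B * L' + B' * L"])
    show "\<bar>\<phi> x * \<psi> x\<bar> \<le> B * B'" for x
      unfolding abs_mult using 1 2 by (intro mult_mono) auto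
    fix x y
    let ?d = "L2_set (\<lambda>i. x i - y i) {..<n}"
    have "\<phi> x * \<psi> x - \<phi> y * \<psi> y = \<phi> x * (\<psi> x - \<psi> y) + \<psi> y * (\<phi> x - \<phi> y)"
      by (simp add: algebra_simps)
    also have "\<bar>\<dots>\<bar> \<le> \<bar>\<phi> x\<bar> * \<bar>\<psi> x - \<psi> y\<bar> + \<bar>\<psi> y\<bar> * \<bar>\<phi> x - \<phi> y\<bar>"
      by (metis abs_mult abs_triangle_ineq)
    also have "\<dots> \<le> B * (L' * ?d) + B' * (L * ?d)"
      using 1 2 by (intro add_mono mult_mono) auto
    finally show "\<bar>\<phi> x * \<psi> x - \<phi> y * \<psi> y\<bar> \<le> (B * L' + B' * L) * ?d"
      by (simp add: algebra_simps)
  qed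
qed

lemma C_b_Lip_max:
  assumes "\<phi> \<in> C_b_Lip n" "\<psi> \<in> C_b_Lip n"
  shows "(\<lambda>x. max (\<phi> x) (\<psi> x)) \<in> C_b_Lip n"
proof -
  obtain B L where 1: "0 \<le> B" "\<And>x. \<bar>\<phi> x\<bar> \<le> B" "0 \<le> L"
    "\<And>x y. \<bar>\<phi> x - \<phi> y\<bar> \<le> L * L2_set (\<lambda>i. x i - y i) {..<n}"
    using assms(1) by (rule C_b_LipE) (rule that)
  obtain B' L' where 2: "0 \<le> B'" "\<And>x. \<bar>\<psi> x\<bar> \<le> B'" "0 \<le> L'"
    "\<And>x y. \<bar>\<psi> x - \<psi> y\<bar> \<le> L' * L2_set (\<lambda>i. x i - y i) {..<n}"
    using assms(2) by (rule C_b_LipE) (rule that)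
  show ?thesis
  proof (rule C_b_LipI[of _ "B + B'" "L + L'"])
    show "\<bar>max (\<phi> x) (\<psi> x)\<bar> \<le> B + B'" for x
      using 1(1) 1(2)[of x] 2(1) 2(2)[of x] by linarith
    fix x y
    have "\<bar>max (\<phi> x) (\<psi> x) - max (\<phi> y) (\<psi> y)\<bar> \<le> \<bar>\<phi> x - \<phi> y\<bar> + \<bar>\<psi> x - \<psi> y\<bar>"
      by linarith
    also have "\<dots> \<le> (L + L') * L2_set (\<lambda>i. x i - y i) {..<n}"
      using 1(4)[of x y] 2(4)[of x y] by (simp add: distrib_right)
    finally show "\<bar>max (\<phi> x) (\<psi> x) - max (\<phi> y) (\<psi> y)\<bar> \<le> (L + L') * L2_set (\<lambda>i. x i - y i) {..<n}" .
  qed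
qed

lemma C_b_Lip_mono:
  assumes "\<phi> \<in> C_b_Lip k" "k \<le> n"
  shows "\<phi> \<in> C_b_Lip n"
proof -
  obtain B L where 1: "0 \<le> B" "\<And>x. \<bar>\<phi> x\<bar> \<le> B" "0 \<le> L"
    "\<And>x y. \<bar>\<phi> x - \<phi> y\<bar> \<le> L * L2_set (\<lambda>i. x i - y i) {..<k}"
    using assms(1) by (rule C_b_LipE) (rule that)
  have "L2_set z {..<k} \<le> L2_set z {..<n}" for z
    unfolding L2_set_def using assms(2) by (intro real_sqrt_le_mono sum_mono2) auto
  then show ?thesis
    using 1(2) by (intro C_b_LipI[of _ B L] order_trans[OF 1(4)] mult_left_mono 1(3))
qed

text \<open>A function in \<^term>\<open>C_b_Lip n\<close> sees only the first \<open>n\<close> coordinates; this lets a function of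
  the past ignore the coordinate appended by \<^term>\<open>join\<close>.\<close>

lemma C_b_Lip_cong:
  assumes "\<phi> \<in> C_b_Lip n" "\<And>i. i < n \<Longrightarrow> x i = y i"
  shows "\<phi> x = \<phi> y"
proof -
  obtain B L where 1: "0 \<le> B" "\<And>x. \<bar>\<phi> x\<bar> \<le> B" "0 \<le> L"
    "\<And>x y. \<bar>\<phi> x - \<phi> y\<bar> \<le> L * L2_set (\<lambda>i. x i - y i) {..<n}"
    using assms(1) by (rule C_b_LipE) (rule that)
  have "L2_set (\<lambda>i. x i - y i) {..<n} = 0"
    using assms(2) by (simp add: L2_set_eq_0_iff)
  then show ?thesis using 1(4)[of x y] by simp
qed

lemma C_b_Lip_of_sum:
  assumes "bounded_lipschitz u" "A \<subseteq> {..<n}"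
  shows "(\<lambda>x. u (\<Sum>i\<in>A. x i)) \<in> C_b_Lip n"
proof -
  obtain B L where B: "\<And>t. \<bar>u t\<bar> \<le> B" and L: "\<And>s t. \<bar>u s - u t\<bar> \<le> L * \<bar>s - t\<bar>"
    using assms(1) unfolding bounded_lipschitz_def by blast
  show ?thesis
  proof (rule C_b_LipI[of _ B "\<bar>L\<bar> * card A"])
    fix x y :: "nat \<Rightarrow> real"
    let ?d = "L2_set (\<lambda>i. x i - y i) {..<n}"
    have "\<bar>(\<Sum>i\<in>A. x i) - (\<Sum>i\<in>A. y i)\<bar> \<le> (\<Sum>i\<in>A. \<bar>x i - y i\<bar>)"
      by (metis sum_abs sum_subtractf)
    also have "\<dots> \<le> (\<Sum>i\<in>A. ?d)"
    proof (rule sum_mono)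
      fix i assume "i \<in> A"
      then have "\<bar>x i - y i\<bar> \<le> L2_set (\<lambda>i. \<bar>x i - y i\<bar>) {..<n}"
        using assms(2) by (intro member_le_L2_set) auto
      then show "\<bar>x i - y i\<bar> \<le> ?d" by (simp add: L2_set_def)
    qed
    finally have *: "\<bar>(\<Sum>i\<in>A. x i) - (\<Sum>i\<in>A. y i)\<bar> \<le> card A * ?d" by simp
    have "\<bar>u (\<Sum>i\<in>A. x i) - u (\<Sum>i\<in>A. y i)\<bar> \<le> \<bar>L\<bar> * \<bar>(\<Sum>i\<in>A. x i) - (\<Sum>i\<in>A. y i)\<bar>"
      by (rule order_trans[OF L]) (intro mult_right_mono, auto)
    also have "\<dots> \<le> \<bar>L\<bar> * (card A * ?d)" using * by (intro mult_left_mono) auto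
    finally show "\<bar>u (\<Sum>i\<in>A. x i) - u (\<Sum>i\<in>A. y i)\<bar> \<le> \<bar>L\<bar> * card A * ?d" by (simp add: mult.assoc)
  qed (rule B)
qed

lemma C_b_Lip_subset_C_l_Lip: "C_b_Lip n \<subseteq> C_l_Lip n"
proof
  fix \<phi> assume "\<phi> \<in> C_b_Lip n"
  obtain B L where L: "0 \<le> B" "\<And>x. \<bar>\<phi> x\<bar> \<le> B" "0 \<le> L"
    "\<And>x y. \<bar>\<phi> x - \<phi> y\<bar> \<le> L * L2_set (\<lambda>i. x i - y i) {..<n}"
    using \<open>\<phi> \<in> C_b_Lip n\<close> by (rule C_b_LipE) (rule that)
  have "\<bar>\<phi> x - \<phi> y\<bar> \<le> (L + 1) * (1 + L2_set x {..<n} ^ 0 + L2_set y {..<n} ^ 0)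
                       * L2_set (\<lambda>i. x i - y i) {..<n}" for x y
    by (rule order_trans[OF L(4)]) (use L(3) in \<open>auto intro!: mult_right_mono\<close>)
  moreover have "L + 1 > 0" using L(3) by simp
  ultimately show "\<phi> \<in> C_l_Lip n" unfolding C_l_Lip_def by blast
qed

text \<open>The Lipschitz substitute for the indicator of a half line: it rises from 0 at the origin to 1
  at \<open>d\<close>.\<close>

definition ramp :: "real \<Rightarrow> real \<Rightarrow> real" where
  "ramp d t = max 0 (min 1 (t / d))"

lemma ramp_bounds: "0 \<le> ramp d t" "ramp d t \<le> 1"
  by (auto simp: ramp_def)

lemma ramp_eq_1: "0 < d \<Longrightarrow> d \<le> t \<Longrightarrow> ramp d t = 1"
  by (simp add: ramp_def)

lemma ramp_pos_iff: "0 < d \<Longrightarrow> 0 < ramp d t \<longleftrightarrow> 0 < t"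
  by (auto simp: ramp_def less_max_iff_disj zero_less_divide_iff)

lemma bounded_lipschitz_ramp:
  assumes "0 < d" and v: "\<And>s t. \<bar>v s - v t\<bar> \<le> \<bar>s - t\<bar>"
  shows "bounded_lipschitz (\<lambda>t. ramp d (v t))"
proof -
  have "\<bar>ramp d (v s) - ramp d (v t)\<bar> \<le> (1 / d) * \<bar>s - t\<bar>" for s t
  proof -
    have "\<bar>ramp d (v s) - ramp d (v t)\<bar> \<le> \<bar>v s / d - v t / d\<bar>"
      unfolding ramp_def by linarith
    also have "\<dots> = (1 / d) * \<bar>v s - v t\<bar>"
      using assms(1) by (simp add: diff_divide_distrib[symmetric])
    also have "\<dots> \<le> (1 / d) * \<bar>s - t\<bar>" using assms by (intro mult_left_mono) auto
    finally show ?thesis .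
  qed
  moreover have "\<bar>ramp d (v t)\<bar> \<le> 1" for t using ramp_bounds[of d "v t"] by simp
  ultimately show ?thesis unfolding bounded_lipschitz_def by blast
qed

lemma bounded_lipschitz_diff_const:
  assumes "bounded_lipschitz u"
  shows "bounded_lipschitz (\<lambda>t. u t - c)"
proof -
  obtain B L where *: "\<And>t. \<bar>u t\<bar> \<le> B" "\<And>s t. \<bar>u s - u t\<bar> \<le> L * \<bar>s - t\<bar>"
    using assms unfolding bounded_lipschitz_def by blast
  have "\<bar>u t - c\<bar> \<le> B + \<bar>c\<bar>" for t using *(1)[of t] by linarith
  moreover have "\<bar>u s - c - (u t - c)\<bar> \<le> L * \<bar>s - t\<bar>" for s t using *(2)[of s t] by simp
  ultimately show ?thesis unfolding bounded_lipschitz_def by blast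
qed

text \<open>Starting the maximum at the value 0 makes the telescoping sum of its increments equal to the
  running maximum itself, and makes every positive increment force a positive new entry.\<close>

primrec running_max :: "(nat \<Rightarrow> real) \<Rightarrow> nat \<Rightarrow> real" where
  "running_max z 0 = 0"
| "running_max z (Suc k) = max (running_max z k) (z (Suc k))"

lemma running_max_bounds:
  assumes "\<And>k. z k \<le> 1"
  shows "0 \<le> running_max z k" "running_max z k \<le> 1"
proof -
  show "0 \<le> running_max z k" by (induction k) auto
  show "running_max z k \<le> 1" using assms by (induction k) auto
qed

lemma running_max_ge: "1 \<le> k \<Longrightarrow> k \<le> n \<Longrightarrow> z k \<le> running_max z n"
proof (induction n)
  case (Suc n)
  then show ?case by (cases "k = Suc n") (simp_all add: le_max_iff_disj)
qed simp

lemma C_b_Lip_running_max: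
  assumes "\<And>j. 1 \<le> j \<Longrightarrow> j \<le> k \<Longrightarrow> (\<lambda>x. Z j x) \<in> C_b_Lip n"
  shows "(\<lambda>x. running_max (\<lambda>j. Z j x) k) \<in> C_b_Lip n"
  using assms
proof (induction k)
  case 0
  show ?case by (simp add: C_b_Lip_const)
next
  case (Suc k)
  have "(\<lambda>x. running_max (\<lambda>j. Z j x) k) \<in> C_b_Lip n" using Suc by simp
  moreover have "(\<lambda>x. Z (Suc k) x) \<in> C_b_Lip n" using Suc.prems by simp
  ultimately show ?case using C_b_Lip_max by simp
qed

section \<open>Sub-linear expectations of bounded variables\<close>

context sublinear_expectation_space
begin

lemma const_in_H: "(\<lambda>_. c) \<in> H"
  using H_compose[of 0 "\<lambda>_ _. 0" "\<lambda>_. c"] subsetD[OF C_b_Lip_subset_C_l_Lip C_b_Lip_const] by simp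

lemma C_b_Lip_in_H:
  assumes "\<phi> \<in> C_b_Lip n" "\<And>i. i < n \<Longrightarrow> Y i \<in> H"
  shows "(\<lambda>\<omega>. \<phi> (\<lambda>i. Y i \<omega>)) \<in> H"
  using H_compose[of n Y \<phi>] subsetD[OF C_b_Lip_subset_C_l_Lip assms(1)] assms(2) by simp

lemma H_sum:
  assumes "finite A" "\<And>k. k \<in> A \<Longrightarrow> Y k \<in> H"
  shows "(\<lambda>\<omega>. \<Sum>k\<in>A. Y k \<omega>) \<in> H"
  using assms by (induction A) (simp_all add: H_zero H_add)

text \<open>Comparison with constants: on bounded variables the expectation is a genuine real number, so
  that \<^const>\<open>real_of_ereal\<close> in the definition of independence is harmless.\<close>

lemma bounded_expectation:
  assumes "Y \<in> H" "\<And>\<omega>. \<omega> \<in> space M \<Longrightarrow> \<bar>Y \<omega>\<bar> \<le> B"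
  shows "E Y = ereal (real_of_ereal (E Y))" "\<bar>real_of_ereal (E Y)\<bar> \<le> B"
proof -
  have "E Y \<le> ereal B" "ereal (- B) \<le> E Y"
    using mono[OF const_in_H[of B] assms(1)] mono[OF assms(1) const_in_H[of "- B"]] assms(2)
    by (force simp: const abs_le_iff)+
  then show "E Y = ereal (real_of_ereal (E Y))" "\<bar>real_of_ereal (E Y)\<bar> \<le> B"
    by (cases "E Y"; simp)+
qed

lemma expectation_add_le:
  assumes "X \<in> H" "Y \<in> H" "E X \<le> ereal a" "E Y \<le> ereal b"
  shows "E (\<lambda>\<omega>. X \<omega> + Y \<omega>) \<le> ereal (a + b)"
proof -
  have "E (\<lambda>\<omega>. X \<omega> + Y \<omega>) \<le> E X + E Y" using assms by (intro subadd) auto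
  also have "\<dots> \<le> ereal a + ereal b" using assms by (intro add_mono) auto
  finally show ?thesis by simp
qed

lemma expectation_sum_nonpos:
  assumes "finite A" "\<And>k. k \<in> A \<Longrightarrow> Y k \<in> H" "\<And>k. k \<in> A \<Longrightarrow> E (Y k) \<le> 0"
  shows "E (\<lambda>\<omega>. \<Sum>k\<in>A. Y k \<omega>) \<le> 0"
  using assms
proof (induction A)
  case empty
  then show ?case using const[of 0] by simp
next
  case (insert a A)
  then show ?case
    using expectation_add_le[of "Y a" "\<lambda>\<omega>. \<Sum>k\<in>A. Y k \<omega>" 0 0] H_sum[of A Y]
    by (simp add: zero_ereal_def)
qed

lemma bounded_lipschitz_in_H:
  assumes "bounded_lipschitz u" "Y \<in> H"
  shows "(\<lambda>\<omega>. u (y + Y \<omega>)) \<in> H"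
proof -
  have "bounded_lipschitz (\<lambda>t. u (y + t))"
    using assms(1) unfolding bounded_lipschitz_def by (metis add_diff_cancel_left)
  from C_b_Lip_in_H[OF C_b_Lip_of_sum[OF this, of "{0}" 1], of "\<lambda>_. Y"] assms(2)
  show ?thesis by simp
qed

text \<open>Integrating out one variable stays within the class of functions to which independence
  applies. The Lipschitz constant is inherited because \<open>u (s + Y) \<le> u (t + Y) + L * \<bar>s - t\<bar>\<close> pointwise,
  and constants pass through a sub-linear expectation.\<close>

lemma bounded_lipschitz_expectation_translate:
  assumes "bounded_lipschitz u" "Y \<in> H"
  shows "bounded_lipschitz (\<lambda>y. real_of_ereal (E (\<lambda>\<omega>. u (y + Y \<omega>))))"
proof -
  obtain B L where B: "\<And>t. \<bar>u t\<bar> \<le> B" and L: "\<And>s t. \<bar>u s - u t\<bar> \<le> L * \<bar>s - t\<bar>"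
    using assms unfolding bounded_lipschitz_def by blast
  define w where "w y = real_of_ereal (E (\<lambda>\<omega>. u (y + Y \<omega>)))" for y
  note inH = bounded_lipschitz_in_H[OF assms]
  have w: "E (\<lambda>\<omega>. u (y + Y \<omega>)) = ereal (w y)" "\<bar>w y\<bar> \<le> B" for y
    unfolding w_def using bounded_expectation[OF inH B] by auto
  have le: "w s \<le> w t + L * \<bar>s - t\<bar>" for s t
  proof -
    have "E (\<lambda>\<omega>. u (s + Y \<omega>)) \<le> E (\<lambda>\<omega>. u (t + Y \<omega>) + L * \<bar>s - t\<bar>)"
    proof (rule mono)
      fix \<omega>
      show "u (s + Y \<omega>) \<le> u (t + Y \<omega>) + L * \<bar>s - t\<bar>"
        using L[of "s + Y \<omega>" "t + Y \<omega>"] by simp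
    qed (intro H_add inH const_in_H)+
    also have "\<dots> \<le> ereal (w t + L * \<bar>s - t\<bar>)"
      using w by (intro expectation_add_le inH const_in_H) (auto simp: const)
    finally show ?thesis using w by simp
  qed
  have "\<bar>w s - w t\<bar> \<le> L * \<bar>s - t\<bar>" for s t
    using le[of s t] le[of t s] by (simp add: abs_minus_commute abs_le_iff)
  then show ?thesis using w(2) unfolding bounded_lipschitz_def w_def[symmetric] by blast
qed

section \<open>Conditioning on an initial block\<close>

text \<open>
  Independence integrates out the last variable \<open>Y\<^sub>j\<close> given the earlier ones. The nonnegative past
  factor \<open>\<psi>\<close> comes out of the inner expectation by positive homogeneity, and what remains is a bounded
  Lipschitz function of the shorter sum, so the procedure iterates until no future is left. The order
  of the quantifiers matters: \<open>c\<close> depends on \<open>u\<close> alone, so the choice \<open>\<psi> = 1\<close> identifies it as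
  the expectation of the future factor.
\<close>

lemma expectation_future_reduces_to_const:
  assumes Y: "\<And>i. i < n \<Longrightarrow> Y i \<in> H"
    and indep: "\<And>j. 1 \<le> j \<Longrightarrow> j < n \<Longrightarrow> independent_to H E 1 (\<lambda>_. Y j) j Y"
    and "1 \<le> k" "k \<le> j" "j \<le> n" "bounded_lipschitz u"
  shows "\<exists>c. \<forall>\<psi>\<in>C_b_Lip k. (\<forall>x. 0 \<le> \<psi> x) \<longrightarrow>
    E (\<lambda>\<omega>. \<psi> (\<lambda>i. Y i \<omega>) * u (\<Sum>i=k..<j. Y i \<omega>)) = E (\<lambda>\<omega>. \<psi> (\<lambda>i. Y i \<omega>) * c)"
  using assms(4-6)
proof (induction j arbitrary: u rule: dec_induct)
  case base
  show ?case by auto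
next
  case (step j)
  define w where "w y = real_of_ereal (E (\<lambda>\<omega>. u (y + Y j \<omega>)))" for y
  have Yj: "Y j \<in> H" using Y step by simp
  obtain B where B: "\<And>t. \<bar>u t\<bar> \<le> B" using step.prems unfolding bounded_lipschitz_def by blast
  have "bounded_lipschitz w"
    unfolding w_def using step.prems Yj by (intro bounded_lipschitz_expectation_translate)
  then obtain c where c: "\<forall>\<psi>\<in>C_b_Lip k. (\<forall>x. 0 \<le> \<psi> x) \<longrightarrow>
    E (\<lambda>\<omega>. \<psi> (\<lambda>i. Y i \<omega>) * w (\<Sum>i=k..<j. Y i \<omega>)) = E (\<lambda>\<omega>. \<psi> (\<lambda>i. Y i \<omega>) * c)"
    using step.IH[OF Suc_leD[OF step.prems(1)]] by blast
  show ?case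
  proof (intro exI[of _ c] ballI impI)
    fix \<psi> assume \<psi>: "\<psi> \<in> C_b_Lip k" "\<forall>x. 0 \<le> \<psi> x"
    \<comment> \<open>The integrand as a function of all \<open>j + 1\<close> variables, the test function for independence.\<close>
    define \<phi> where "\<phi> z = \<psi> z * u (\<Sum>i=k..<Suc j. z i)" for z :: "nat \<Rightarrow> real"
    have \<phi>: "\<phi> \<in> C_b_Lip (j + 1)"
      unfolding \<phi>_def using step \<psi>(1)
      by (intro C_b_Lip_mult C_b_Lip_of_sum) (auto intro: C_b_Lip_mono)
    have \<phi>_join: "\<phi> (join j x (\<lambda>_. t)) = \<psi> x * u ((\<Sum>i=k..<j. x i) + t)" for x t
    proof -
      have "\<psi> (join j x (\<lambda>_. t)) = \<psi> x"
        using step by (intro C_b_Lip_cong[OF \<psi>(1)]) (auto simp: join_def)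
      then show ?thesis using step by (simp add: \<phi>_def join_def)
    qed
    have inner: "E (\<lambda>\<omega>. \<psi> x * u (y + Y j \<omega>)) = ereal (\<psi> x * w y)" for x y
    proof -
      have "E (\<lambda>\<omega>. \<psi> x * u (y + Y j \<omega>)) = ereal (\<psi> x) * E (\<lambda>\<omega>. u (y + Y j \<omega>))"
        using \<psi>(2) step.prems Yj by (intro pos_homogeneous bounded_lipschitz_in_H) auto
      also have "E (\<lambda>\<omega>. u (y + Y j \<omega>)) = ereal (w y)"
        unfolding w_def using bounded_lipschitz_in_H[OF step.prems(2) Yj] B
        by (intro bounded_expectation) auto
      finally show ?thesis by simp
    qed
    have "E (\<lambda>\<omega>. \<psi> (\<lambda>i. Y i \<omega>) * u (\<Sum>i=k..<Suc j. Y i \<omega>))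
        = E (\<lambda>\<omega>. \<phi> (join j (\<lambda>i. Y i \<omega>) (\<lambda>_. Y j \<omega>)))"
      using step by (simp add: \<phi>_join)
    also have "\<dots> = E (\<lambda>\<omega>. real_of_ereal (E (\<lambda>\<omega>'. \<phi> (join j (\<lambda>i. Y i \<omega>) (\<lambda>_. Y j \<omega>')))))"
      using indep[of j] step \<open>1 \<le> k\<close> \<phi> unfolding independent_to_def by auto
    also have "\<dots> = E (\<lambda>\<omega>. \<psi> (\<lambda>i. Y i \<omega>) * w (\<Sum>i=k..<j. Y i \<omega>))"
      by (simp add: \<phi>_join inner)
    also have "\<dots> = E (\<lambda>\<omega>. \<psi> (\<lambda>i. Y i \<omega>) * c)" using c \<psi> by blast
    finally show "E (\<lambda>\<omega>. \<psi> (\<lambda>i. Y i \<omega>) * u (\<Sum>i=k..<Suc j. Y i \<omega>)) = E (\<lambda>\<omega>. \<psi> (\<lambda>i. Y i \<omega>) * c)" .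
  qed
qed

text \<open>The constant that replaces the future factor is the expectation of that factor, hence
  nonpositive; multiplied by a nonnegative past factor it remains so.\<close>

lemma expectation_past_times_future_nonpos:
  assumes Y: "\<And>i. i < n \<Longrightarrow> Y i \<in> H"
    and indep: "\<And>j. 1 \<le> j \<Longrightarrow> j < n \<Longrightarrow> independent_to H E 1 (\<lambda>_. Y j) j Y"
    and k: "1 \<le> k" "k \<le> n"
    and u: "bounded_lipschitz u" "E (\<lambda>\<omega>. u (\<Sum>i=k..<n. Y i \<omega>)) \<le> 0"
    and \<psi>: "\<psi> \<in> C_b_Lip k" "\<And>x. 0 \<le> \<psi> x"
  shows "E (\<lambda>\<omega>. \<psi> (\<lambda>i. Y i \<omega>) * u (\<Sum>i=k..<n. Y i \<omega>)) \<le> 0"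
proof -
  obtain c where c: "\<And>\<psi>. \<psi> \<in> C_b_Lip k \<Longrightarrow> (\<forall>x. 0 \<le> \<psi> x) \<Longrightarrow>
    E (\<lambda>\<omega>. \<psi> (\<lambda>i. Y i \<omega>) * u (\<Sum>i=k..<n. Y i \<omega>)) = E (\<lambda>\<omega>. \<psi> (\<lambda>i. Y i \<omega>) * c)"
    using expectation_future_reduces_to_const[OF Y indep k(1) k(2) order_refl u(1)] by blast
  have "c \<le> 0"
    using c[of "\<lambda>_. 1"] u(2) const[of c] by (simp add: C_b_Lip_const)
  have "(\<lambda>\<omega>. \<psi> (\<lambda>i. Y i \<omega>)) \<in> H"
    using C_b_Lip_in_H[OF \<psi>(1), of Y] Y k by simp
  then have "E (\<lambda>\<omega>. c * \<psi> (\<lambda>i. Y i \<omega>)) \<le> E (\<lambda>_. 0)"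
    using \<open>c \<le> 0\<close> \<psi>(2) by (intro mono H_scale H_zero) (simp_all add: mult_nonpos_nonneg)
  also have "(\<lambda>\<omega>. c * \<psi> (\<lambda>i. Y i \<omega>)) = (\<lambda>\<omega>. \<psi> (\<lambda>i. Y i \<omega>) * c)"
    by (simp only: mult.commute)
  also have "E \<dots> = E (\<lambda>\<omega>. \<psi> (\<lambda>i. Y i \<omega>) * u (\<Sum>i=k..<n. Y i \<omega>))"
    using c[OF \<psi>(1)] \<psi>(2) by simp
  finally show ?thesis by (simp add: const zero_ereal_def)
qed

section \<open>Capacity and the maximal inequality\<close>

text \<open>The competitors \<open>\<xi>\<close> in the capacity need not be functions of the variables at hand.
  Sandwiching the indicator between members of \<open>H\<close> avoids dealing with them.\<close>

lemma expectation_le_capacity: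
  assumes "Y \<in> H" "\<And>\<omega>. \<omega> \<in> space M \<Longrightarrow> Y \<omega> \<le> indicator A \<omega>"
  shows "E Y \<le> upper_capacity M H E A"
  unfolding upper_capacity_def
proof (rule Inf_greatest)
  fix e assume "e \<in> {E \<xi> |\<xi>. \<xi> \<in> H \<and> (\<forall>\<omega>\<in>space M. indicator A \<omega> \<le> \<xi> \<omega>)}"
  then obtain \<xi> where \<xi>: "e = E \<xi>" "\<xi> \<in> H" "\<And>\<omega>. \<omega> \<in> space M \<Longrightarrow> indicator A \<omega> \<le> \<xi> \<omega>"
    by blast
  show "E Y \<le> e"
    unfolding \<xi>(1) using assms(2) \<xi>(3) by (intro mono \<xi>(2) assms(1)) (rule order_trans)
qed

lemma capacity_le_expectation:
  assumes "Y \<in> H" "\<And>\<omega>. \<omega> \<in> space M \<Longrightarrow> indicator A \<omega> \<le> Y \<omega>"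
  shows "upper_capacity M H E A \<le> E Y"
  unfolding upper_capacity_def using assms by (intro Inf_lower) blast

text \<open>
  The gap \<open>\<epsilon> = 4d\<close> accommodates four ramps of width \<open>d\<close>. The ramp \<open>z\<^sub>k\<close> is positive only
  if \<open>f S\<^sub>k - \<beta>\<^sub>k > x + 3d\<close> and is 1 beyond \<open>x + 4d\<close>; the ramp \<open>p\<^sub>k\<close> is positive only if
  \<open>f (S\<^sub>k - S\<^sub>n) > \<beta>\<^sub>k + d\<close> and is 1 from \<open>\<beta>\<^sub>k + 2d\<close> on; the ramp \<open>h\<close> is positive only if
  \<open>f S\<^sub>n > x\<close> and is 1 from \<open>x + d\<close> on. By subadditivity of \<open>f\<close>, positivity of \<open>z\<^sub>k\<close> then forces
  \<open>p\<^sub>k = 1\<close> or \<open>h = 1\<close>.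
\<close>

lemma ottaviani_inequality:
  assumes indep: "independent_rvs H E n X"
    and \<alpha>: "0 < \<alpha>" "\<alpha> < 1" and n: "1 \<le> n"
    and S_def: "\<And>k \<omega>. S k \<omega> = (\<Sum>i=1..k. X i \<omega>)"
    and f_subadd: "\<And>s t. f (s + t) \<le> f s + f t"
    and f_nonexp: "\<And>s t. \<bar>f s - f t\<bar> \<le> \<bar>s - t\<bar>"
    and tail: "\<And>\<epsilon> k. 0 < \<epsilon> \<Longrightarrow> k \<in> {1..n} \<Longrightarrow>
      upper_capacity M H E {\<omega> \<in> space M. f (S k \<omega> - S n \<omega>) \<ge> \<beta> k + \<epsilon>} \<le> ereal \<alpha>"
    and \<epsilon>: "0 < \<epsilon>"
  shows "ereal (1 - \<alpha>) * upper_capacity M H E {\<omega> \<in> space M. (MAX k\<in>{1..n}. f (S k \<omega>) - \<beta> k) > x + \<epsilon>}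
    \<le> upper_capacity M H E {\<omega> \<in> space M. f (S n \<omega>) > x}"
proof -
  \<comment> \<open>The past of \<open>Y j\<close> is \<open>Y 0, \<dots>, Y (j - 1)\<close>, in the indexing from 0 that independence uses.\<close>
  define Y where "Y i = X (Suc i)" for i
  define d where "d = \<epsilon> / 4"
  have d: "0 < d" "\<epsilon> = 4 * d" using \<epsilon> by (auto simp: d_def)
  have Y: "Y i \<in> H" if "i < n" for i
    using indep that by (auto simp: independent_rvs_def Y_def)
  have indep_Y: "independent_to H E 1 (\<lambda>_. Y j) j Y" if "1 \<le> j" "j < n" for j
    using indep that by (auto simp: independent_rvs_def Y_def[abs_def])
  have S: "S k \<omega> = (\<Sum>i<k. Y i \<omega>)" for k \<omega>
    by (simp add: S_def Y_def sum.atLeast1_atMost_eq)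
  have S_diff: "S n \<omega> - S k \<omega> = (\<Sum>i=k..<n. Y i \<omega>)" if "k \<le> n" for k \<omega>
  proof -
    have "(\<Sum>i<n. Y i \<omega>) = (\<Sum>i<k. Y i \<omega>) + (\<Sum>i=k..<n. Y i \<omega>)"
      using sum.atLeastLessThan_concat[of 0 k n "\<lambda>i. Y i \<omega>"] that by (simp add: lessThan_atLeast0)
    then show ?thesis by (simp add: S)
  qed
  define z where "z k t = ramp d (f t - \<beta> k - x - 3 * d)" for k t
  \<comment> \<open>The argument of \<open>p k\<close> is the future increment \<open>S n - S k\<close>, hence the change of sign.\<close>
  define p where "p k t = ramp d (f (- t) - \<beta> k - d)" for k t
  define h where "h t = ramp d (f t - x)" for t
  define W where "W k y = running_max (\<lambda>j. z j (\<Sum>i<j. y i)) k" for k and y :: "nat \<Rightarrow> real"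
  have lip: "bounded_lipschitz (z k)" "bounded_lipschitz (p k)" "bounded_lipschitz h" for k
  proof -
    have "\<bar>f (- s) - f (- t)\<bar> \<le> \<bar>s - t\<bar>" for s t using f_nonexp[of "- s" "- t"] by simp
    then show "bounded_lipschitz (z k)" "bounded_lipschitz (p k)" "bounded_lipschitz h"
      unfolding z_def p_def h_def using d(1) f_nonexp by (auto intro!: bounded_lipschitz_ramp)
  qed
  have W_lip: "W k \<in> C_b_Lip m" if "k \<le> m" for k m
    unfolding W_def using that lip by (intro C_b_Lip_running_max C_b_Lip_of_sum) auto
  have W_bounds: "0 \<le> W k y" "W k y \<le> 1" for k y
    unfolding W_def by (intro running_max_bounds; simp add: z_def ramp_bounds)+
  have W_0: "W 0 y = 0" and W_Suc: "W (Suc k) y = max (W k y) (z (Suc k) (\<Sum>i<Suc k. y i))" for k y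
    by (simp_all add: W_def)
  define D where "D k y = W k y - W (k - 1) y" for k y
  have D_nonneg: "0 \<le> D k y" for k y
    by (cases k) (simp_all add: D_def W_Suc)
  have D_sum: "(\<Sum>k=1..m. D k y) = W m y" for m y
    by (induction m) (simp_all add: D_def W_0)
  define T where "T k \<omega> = D k (\<lambda>i. Y i \<omega>) * (p k (\<Sum>i=k..<n. Y i \<omega>) - \<alpha>)" for k \<omega>
  have sum_in_H: "(\<lambda>\<omega>. u (\<Sum>i=k..<n. Y i \<omega>)) \<in> H" if "bounded_lipschitz u" for u k
    using C_b_Lip_in_H[OF C_b_Lip_of_sum[OF that, of "{k..<n}" n], of Y] Y by fastforce
  have D_lip: "D k \<in> C_b_Lip m" if "k \<le> m" for k m
    unfolding D_def[abs_def] using that by (intro C_b_Lip_diff W_lip) auto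
  have T_in_H: "T k \<in> H" if "k \<in> {1..n}" for k
  proof -
    have "(\<lambda>y. p k (\<Sum>i=k..<n. y i)) \<in> C_b_Lip n"
      using lip(2) by (intro C_b_Lip_of_sum) auto
    then have "(\<lambda>y. D k y * (p k (\<Sum>i=k..<n. y i) - \<alpha>)) \<in> C_b_Lip n"
      using that by (intro C_b_Lip_mult D_lip C_b_Lip_diff C_b_Lip_const) auto
    from C_b_Lip_in_H[OF this, of Y] Y show ?thesis by (simp add: T_def[abs_def])
  qed
  have T_nonpos: "E (T k) \<le> 0" if k: "k \<in> {1..n}" for k
    unfolding T_def[abs_def]
  proof (rule expectation_past_times_future_nonpos[OF Y indep_Y, where u = "\<lambda>t. p k t - \<alpha>"])
    have "E (\<lambda>\<omega>. p k (\<Sum>i=k..<n. Y i \<omega>))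
        \<le> upper_capacity M H E {\<omega> \<in> space M. f (S k \<omega> - S n \<omega>) \<ge> \<beta> k + d}"
    proof (rule expectation_le_capacity[OF sum_in_H[OF lip(2)]])
      fix \<omega> assume "\<omega> \<in> space M"
      moreover have "- (\<Sum>i=k..<n. Y i \<omega>) = S k \<omega> - S n \<omega>"
        using S_diff[of k \<omega>] k by simp
      ultimately show "p k (\<Sum>i=k..<n. Y i \<omega>)
          \<le> indicator {\<omega> \<in> space M. f (S k \<omega> - S n \<omega>) \<ge> \<beta> k + d} \<omega>"
        using ramp_bounds[of d] ramp_pos_iff[OF d(1), of "f (S k \<omega> - S n \<omega>) - \<beta> k - d"]
        by (auto simp: p_def indicator_def not_less[symmetric])
    qed
    also have "\<dots> \<le> ereal \<alpha>" using tail d(1) k by blast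
    finally show "E (\<lambda>\<omega>. p k (\<Sum>i=k..<n. Y i \<omega>) - \<alpha>) \<le> 0"
      using expectation_add_le[OF sum_in_H[OF lip(2)] const_in_H[of "- \<alpha>"], of k k \<alpha> "- \<alpha>"]
      by (simp add: const zero_ereal_def)
    show "D k \<in> C_b_Lip k" by (rule D_lip) simp
  qed (use k lip in \<open>auto intro: D_nonneg bounded_lipschitz_diff_const\<close>)
  let ?W = "\<lambda>\<omega>. W n (\<lambda>i. Y i \<omega>)"
  let ?h = "\<lambda>\<omega>. h (S n \<omega>)"
  have W_in_H: "?W \<in> H" using C_b_Lip_in_H[OF W_lip[OF order_refl], of n Y] Y by simp
  have h_in_H: "?h \<in> H"
    unfolding S using sum_in_H[OF lip(3), of 0] by (simp add: lessThan_atLeast0)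
  have key: "(1 - \<alpha>) * ?W \<omega> \<le> ?h \<omega> + (\<Sum>k=1..n. T k \<omega>)" for \<omega>
  proof -
    define y where "y = (\<lambda>i. Y i \<omega>)"
    let ?q = "\<lambda>k. p k (\<Sum>i=k..<n. Y i \<omega>)"
    have q: "0 \<le> ?q k" "?q k \<le> 1" for k by (auto simp: p_def ramp_bounds)
    have "(\<Sum>k=1..n. D k y * (1 - ?q k)) \<le> ?h \<omega>"
    proof (cases "?h \<omega> = 1")
      case True
      have "(\<Sum>k=1..n. D k y * (1 - ?q k)) \<le> (\<Sum>k=1..n. D k y)"
        using D_nonneg q by (intro sum_mono mult_left_le) auto
      also have "\<dots> \<le> 1" by (simp only: D_sum W_bounds)
      finally show ?thesis using True by simp
    next
      case False
      then have small: "f (S n \<omega>) < x + d"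
        using ramp_eq_1[OF d(1), of "f (S n \<omega>) - x"] by (force simp: h_def)
      have "D k y * (1 - ?q k) = 0" if k: "k \<in> {1..n}" for k
      proof (cases "0 < z k (S k \<omega>)")
        case True
        then have "f (S k \<omega>) > \<beta> k + x + 3 * d"
          using d(1) by (simp add: z_def ramp_pos_iff)
        moreover have "f (S k \<omega>) \<le> f (S k \<omega> - S n \<omega>) + f (S n \<omega>)"
          using f_subadd[of "S k \<omega> - S n \<omega>" "S n \<omega>"] by simp
        ultimately have "f (S k \<omega> - S n \<omega>) - \<beta> k - d \<ge> d" using small by linarith
        moreover have "- (\<Sum>i=k..<n. Y i \<omega>) = S k \<omega> - S n \<omega>"
          using S_diff[of k \<omega>] k by simp
        ultimately have "?q k = 1" using ramp_eq_1[OF d(1)] by (simp add: p_def)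
        then show ?thesis by simp
      next
        case False
        \<comment> \<open>A new entry that is not positive does not raise the running maximum.\<close>
        obtain l where l: "k = Suc l" using k by (cases k) auto
        have "D k y = 0"
          using False W_bounds(1)[of l y] by (simp add: D_def l W_Suc S y_def)
        then show ?thesis by simp
      qed
      then have "(\<Sum>k=1..n. D k y * (1 - ?q k)) = 0" by (intro sum.neutral) blast
      then show ?thesis by (simp add: h_def ramp_bounds)
    qed
    moreover have "(\<Sum>k=1..n. D k y * (1 - ?q k)) = (\<Sum>k=1..n. (1 - \<alpha>) * D k y - T k \<omega>)"
      by (intro sum.cong) (auto simp: T_def y_def algebra_simps)
    then have "(\<Sum>k=1..n. D k y * (1 - ?q k)) = (1 - \<alpha>) * W n y - (\<Sum>k=1..n. T k \<omega>)"
      by (simp only: sum_subtractf sum_distrib_left[symmetric] D_sum)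
    ultimately show ?thesis by (simp add: y_def)
  qed
  have "upper_capacity M H E {\<omega> \<in> space M. (MAX k\<in>{1..n}. f (S k \<omega>) - \<beta> k) > x + \<epsilon>} \<le> E ?W"
  proof (rule capacity_le_expectation[OF W_in_H])
    fix \<omega>
    show "indicator {\<omega> \<in> space M. (MAX k\<in>{1..n}. f (S k \<omega>) - \<beta> k) > x + \<epsilon>} \<omega> \<le> ?W \<omega>"
    proof (cases "(MAX k\<in>{1..n}. f (S k \<omega>) - \<beta> k) > x + \<epsilon>")
      case True
      then obtain k where k: "k \<in> {1..n}" "f (S k \<omega>) - \<beta> k > x + \<epsilon>"
        using n by (subst (asm) Max_gr_iff) auto
      then have "z k (S k \<omega>) = 1" unfolding z_def using d by (intro ramp_eq_1) auto
      then have "1 \<le> ?W \<omega>"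
        using running_max_ge[of k n "\<lambda>j. z j (\<Sum>i<j. Y i \<omega>)"] k(1) by (simp add: W_def S)
      then show ?thesis using indicator_le_1 order_trans by blast
    next
      case False
      then show ?thesis by (simp add: W_bounds)
    qed
  qed
  then have "ereal (1 - \<alpha>) * upper_capacity M H E {\<omega> \<in> space M. (MAX k\<in>{1..n}. f (S k \<omega>) - \<beta> k) > x + \<epsilon>}
      \<le> ereal (1 - \<alpha>) * E ?W"
    using \<alpha> by (intro ereal_mult_left_mono) auto
  also have "\<dots> = E (\<lambda>\<omega>. (1 - \<alpha>) * ?W \<omega>)"
    using \<alpha> by (intro pos_homogeneous[symmetric] W_in_H) auto
  also have "\<dots> \<le> E (\<lambda>\<omega>. ?h \<omega> + (\<Sum>k=1..n. T k \<omega>))"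
    by (intro mono H_scale H_add h_in_H W_in_H H_sum T_in_H key) auto
  also have "\<dots> \<le> E ?h"
  proof -
    have "E ?h = ereal (real_of_ereal (E ?h))"
      by (rule bounded_expectation(1)[OF h_in_H, of 1]) (simp add: h_def ramp_bounds)
    moreover have "E (\<lambda>\<omega>. \<Sum>k=1..n. T k \<omega>) \<le> ereal 0"
      using expectation_sum_nonpos[of "{1..n}" T] T_in_H T_nonpos by (simp add: zero_ereal_def)
    ultimately show ?thesis
      using expectation_add_le[OF h_in_H H_sum[of "{1..n}" T], of "real_of_ereal (E ?h)" 0] T_in_H
      by simp
  qed
  also have "\<dots> \<le> upper_capacity M H E {\<omega> \<in> space M. f (S n \<omega>) > x}"
  proof (rule expectation_le_capacity[OF h_in_H])
    fix \<omega> assume "\<omega> \<in> space M"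
    then show "?h \<omega> \<le> indicator {\<omega> \<in> space M. f (S n \<omega>) > x} \<omega>"
      using ramp_bounds[of d "f (S n \<omega>) - x"] ramp_pos_iff[OF d(1), of "f (S n \<omega>) - x"]
      by (auto simp: h_def indicator_def not_less[symmetric])
  qed
  finally show ?thesis .
qed

end

theorem lemma2p1:
  fixes M :: "'a measure"
    and H :: "('a \<Rightarrow> real) set"
    and E :: "('a \<Rightarrow> real) \<Rightarrow> ereal"
    and X :: "nat \<Rightarrow> 'a \<Rightarrow> real"
    and n :: nat
    and \<alpha> :: real
    and S :: "nat \<Rightarrow> 'a \<Rightarrow> real"
    and V :: "'a set \<Rightarrow> ereal"
  assumes "sublinear_expectation_space M H E"
    and "1 \<le> n"
    and "independent_rvs H E n X"
    and "0 < \<alpha>" and "\<alpha> < 1"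
    and S_def: "\<And>k \<omega>. S k \<omega> = (\<Sum>i=1..k. X i \<omega>)"
    and V_def: "V = upper_capacity M H E"
  shows "(\<forall>\<beta> :: nat \<Rightarrow> real.
           (\<forall>\<epsilon>>0. \<forall>k\<in>{1..n}. V {\<omega> \<in> space M. S k \<omega> - S n \<omega> \<ge> \<beta> k + \<epsilon>} \<le> ereal \<alpha>) \<longrightarrow>
           (\<forall>x>0. \<forall>\<epsilon>>0.
              ereal (1 - \<alpha>) * V {\<omega> \<in> space M. (MAX k\<in>{1..n}. S k \<omega> - \<beta> k) > x + \<epsilon>}
                \<le> V {\<omega> \<in> space M. S n \<omega> > x})) \<and>
         (\<forall>\<beta> :: nat \<Rightarrow> real.
           (\<forall>\<epsilon>>0. \<forall>k\<in>{1..n}. V {\<omega> \<in> space M. \<bar>S k \<omega> - S n \<omega>\<bar> \<ge> \<beta> k + \<epsilon>} \<le> ereal \<alpha>) \<longrightarrow>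
           (\<forall>x>0. \<forall>\<epsilon>>0.
              ereal (1 - \<alpha>) * V {\<omega> \<in> space M. (MAX k\<in>{1..n}. \<bar>S k \<omega>\<bar> - \<beta> k) > x + \<epsilon>}
                \<le> V {\<omega> \<in> space M. \<bar>S n \<omega>\<bar> > x}))"
proof -
  interpret sublinear_expectation_space M H E by fact
  note ottaviani = ottaviani_inequality[OF assms(3,4,5,2) S_def]
  show ?thesis
    unfolding V_def
    by (intro conjI allI impI; rule ottaviani[where f = "\<lambda>t. t"] ottaviani[where f = abs]) auto
qed

end
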